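(* Let $0\le\alpha<1$ and let $\theta(x,t)$ be a smooth solution, periodic in $x\in\mathbb{R}^d$, of the active scalar equation $\theta_t=(u\cdot\nabla)\theta-(-\Delta)^\alpha\theta$, $\theta(x,0)=\theta_0(x)$, where the velocity $u$ is determined from $\theta$. Suppose that $\omega(\xi,t)$ is continuous in $(\xi,t)$ and piecewise $C^1$ in $t$ for each fixed $\xi$, that for any fixed $t\ge0$ the function $\omega(\cdot,t)$ is a modulus of continuity, that $\partial^2_{\xi\xi}\omega(0,t)=-\infty$ for all $t\ge0$, and that $\theta_0$ obeys $\omega(\cdot,0)$. Suppose moreover that $$\partial_t\omega(\xi,t)>\Omega_\omega(\xi,t)\,\partial_\xi\omega(\xi,t)+D_{\alpha,\omega}(\xi,t)$$ for all $\xi,t>0$ such that $\omega(\xi,t)\le2\|\theta(\cdot,t)\|_{L^\infty}$, where at points at which $\partial_\xi\omega(\xi,t)$ (respectively $\partial_t\omega(\xi,t)$) does not exist, the larger (respectively smaller) value of the one-sided derivative is taken. Suppose that for some $t>0$ the solution $\theta(\cdot,t)$ does not obey $\omega(\cdot,t)$. Then there must exist $t_1>0$ and $x\ne y$ such that for all $t<t_1$, $\theta(\cdot,t)$ obeys $\omega(\cdot,t)$, while $$\theta(x,t_1)-\theta(y,t_1)=\omega(|x-y|,t_1).$$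
   Context: A modulus of continuity is a function $\omega:\mathbb{R}^+\to\mathbb{R}^+$ with $\omega(0)=0$ that is continuous, increasing, concave, and piecewise $C^1$ on $(0,\infty)$ (its derivative is continuous apart from perhaps a finite number of points where one-sided derivatives exist but may not be equal). A function $f$ obeys (has) $\omega$ if $|f(x)-f(y)|<\omega(|x-y|)$ for all $x\ne y$. $\Omega_\omega$ denotes a modulus of continuity, depending on $\omega$ and on the active scalar considered, such that if $\theta$ has modulus of continuity $\omega$, then $u$ has modulus of continuity $\Omega_\omega$ (for example $\Omega_\omega=\omega$ if $u=\theta$); $\Omega_\omega(\xi,t)$ is this function for $\omega(\cdot,t)$. The dissipation expression is $$D_{\alpha,\omega}(\xi)=c_\alpha\left(\int_0^{\xi/2}\frac{\omega(\xi+2\eta)+\omega(\xi-2\eta)-2\omega(\xi)}{\eta^{1+2\alpha}}\,d\eta+\int_{\xi/2}^\infty\frac{\omega(\xi+2\eta)-\omega(2\eta-\xi)-2\omega(\xi)}{\eta^{1+2\alpha}}\,d\eta\right),$$ and $D_{\alpha,\omega}(\xi,t)$ is this expression for $\omega(\cdot,t)$. Here $c_\alpha\in(0,1)$ is a fixed constant for which the one-dimensional fractional heat kernel $\Phi_t$ (the kernel of $e^{-(-\Delta)^\alpha t}$) satisfies $c_\alpha\min(t^{-1/(2\alpha)},t|x|^{-1-2\alpha})\le\Phi_t(x)\le c_\alpha^{-1}\min(t^{-1/(2\alpha)},t|x|^{-1-2\alpha})$. When $\alpha=0$ the dissipative term is absent from the equation, and correspondingly $D_{\alpha,\omega}$ is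 absent. *)

theory Defs
  imports "HOL-Probability.Probability"
begin

section \<open>Moduli of continuity\<close>

definition piecewise_C1 :: "(real \<Rightarrow> real) \<Rightarrow> bool" where
  "piecewise_C1 f \<longleftrightarrow>
     (\<exists>F. finite F \<and> f C1_differentiable_on ({0<..} - F) \<and>
          (\<forall>x\<in>F \<inter> {0<..}. (\<exists>l. (f has_real_derivative l) (at_left x)) \<and>
                          (\<exists>r. (f has_real_derivative r) (at_right x))))"

text \<open>Only the values on \<open>[0, \<infinity>)\<close> are relevant. Monotonicity is not required to be strict, so
  that moduli which are eventually constant are included.\<close>

definition modulus_of_continuity :: "(real \<Rightarrow> real) \<Rightarrow> bool" where
  "modulus_of_continuity w \<longleftrightarrow>
     w 0 = 0 \<and> (\<forall>\<xi>\<ge>0. w \<xi> \<ge> 0) \<and> continuous_on {0..} w \<and> mono_on {0..} w \<and>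
     concave_on {0..} w \<and> piecewise_C1 w"

definition obeys ::
  "('a::real_normed_vector \<Rightarrow> 'b::real_normed_vector) \<Rightarrow> (real \<Rightarrow> real) \<Rightarrow> bool" where
  "obeys f w \<longleftrightarrow> (\<forall>x y. x \<noteq> y \<longrightarrow> norm (f x - f y) < w (norm (x - y)))"

definition upper_deriv :: "(real \<Rightarrow> real) \<Rightarrow> real \<Rightarrow> real" where
  "upper_deriv f x = max (vector_derivative f (at_left x)) (vector_derivative f (at_right x))"

definition lower_deriv :: "(real \<Rightarrow> real) \<Rightarrow> real \<Rightarrow> real" where
  "lower_deriv f x = min (vector_derivative f (at_left x)) (vector_derivative f (at_right x))"

text \<open>The one-sided second derivative at 0 is \<open>-\<infinity>\<close>: the difference quotient of the first
  derivative at 0 tends to \<open>-\<infinity>\<close>. The number \<open>a\<close> is the right derivative at 0; for a modulus of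
  continuity it always exists in \<open>[0, \<infinity>]\<close>, and if it is infinite then the quotient
  is constantly \<open>-\<infinity>\<close>. For a modulus of continuity, \<open>deriv w\<close> is the genuine derivative near 0
  because there are only finitely many exceptional points.\<close>

definition second_deriv_0_MInf :: "(real \<Rightarrow> real) \<Rightarrow> bool" where
  "second_deriv_0_MInf w \<longleftrightarrow>
     (\<exists>a::ereal. ((\<lambda>h. ereal ((w h - w 0) / h)) \<longlongrightarrow> a) (at_right 0) \<and>
                 ((\<lambda>\<xi>. (ereal (deriv w \<xi>) - a) / ereal \<xi>) \<longlongrightarrow> -\<infinity>) (at_right 0))"


section \<open>Smooth and periodic functions\<close>

text \<open>Derivatives are taken within \<open>S\<close>, so that on a closed half space this is smoothness up to
  the boundary.\<close>

primrec Ck_on :: "nat \<Rightarrow> 'a::euclidean_space set \<Rightarrow> ('a \<Rightarrow> 'b::real_normed_vector) \<Rightarrow> bool" where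
  "Ck_on 0 S f \<longleftrightarrow> continuous_on S f"
| "Ck_on (Suc k) S f \<longleftrightarrow>
     (\<exists>f'. (\<forall>x\<in>S. (f has_derivative f' x) (at x within S)) \<and> (\<forall>v. Ck_on k S (\<lambda>x. f' x v)))"

definition smooth_on :: "'a::euclidean_space set \<Rightarrow> ('a \<Rightarrow> 'b::real_normed_vector) \<Rightarrow> bool" where
  "smooth_on S f \<longleftrightarrow> (\<forall>k. Ck_on k S f)"

definition lattice_basis :: "'a::euclidean_space set \<Rightarrow> bool" where
  "lattice_basis P \<longleftrightarrow> independent P \<and> span P = UNIV"

definition periodic :: "'a::euclidean_space set \<Rightarrow> ('a \<Rightarrow> 'b) \<Rightarrow> bool" where
  "periodic P f \<longleftrightarrow> (\<forall>p\<in>P. \<forall>x. f (x + p) = f x)"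


section \<open>The fractional Laplacian and its heat kernel\<close>

text \<open>For functions with period lattice generated by \<open>P\<close>, the operator \<open>(-\<Delta>)\<^sup>\<alpha>\<close> is the Fourier
  multiplier with symbol \<open>|k|\<close> to the power \<open>2\<alpha>\<close>; frequencies range over the dual lattice
  (scaled by \<open>2\<pi>\<close>).\<close>

definition dual_lattice :: "'a::euclidean_space set \<Rightarrow> 'a set" where
  "dual_lattice P = {k. \<forall>p\<in>P. (k \<bullet> p) / (2 * pi) \<in> \<int>}"

definition period_cell :: "'a::euclidean_space set \<Rightarrow> 'a set" where
  "period_cell P = {(\<Sum>p\<in>P. s p *\<^sub>R p) | s. \<forall>p\<in>P. 0 \<le> s p \<and> s p < 1}"

definition fourier_coeff :: "'a::euclidean_space set \<Rightarrow> ('a \<Rightarrow> real) \<Rightarrow> 'a \<Rightarrow> complex" where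
  "fourier_coeff P f k =
     (LINT x:period_cell P|lborel. of_real (f x) * cis (- (k \<bullet> x)))
       / of_real (measure lborel (period_cell P))"

definition frac_laplacian ::
  "'a::euclidean_space set \<Rightarrow> real \<Rightarrow> ('a \<Rightarrow> real) \<Rightarrow> 'a \<Rightarrow> real" where
  "frac_laplacian P \<alpha> f x =
     Re (\<Sum>\<^sub>\<infinity>k\<in>dual_lattice P.
           of_real (norm k powr (2 * \<alpha>)) * fourier_coeff P f k * cis (k \<bullet> x))"

text \<open>The one-dimensional kernel of \<open>exp (- t (-\<Delta>)\<^sup>\<alpha>)\<close>, i.e. the inverse Fourier transform of
  its symbol, which is even in \<open>k\<close>.\<close>

definition frac_heat_kernel :: "real \<Rightarrow> real \<Rightarrow> real \<Rightarrow> real" where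
  "frac_heat_kernel \<alpha> t x =
     (LINT k|lborel. cos (k * x) * exp (- t * \<bar>k\<bar> powr (2 * \<alpha>))) / (2 * pi)"

text \<open>At \<open>x = 0\<close> the second argument of the minimum is \<open>\<infinity>\<close>, whereas \<open>0 powr a = 0\<close>.\<close>

definition heat_kernel_bound :: "real \<Rightarrow> real \<Rightarrow> real \<Rightarrow> real" where
  "heat_kernel_bound \<alpha> t x =
     (if x = 0 then t powr (- 1 / (2 * \<alpha>))
      else min (t powr (- 1 / (2 * \<alpha>))) (t * \<bar>x\<bar> powr (- 1 - 2 * \<alpha>)))"

definition heat_kernel_const :: "real \<Rightarrow> real \<Rightarrow> bool" where
  "heat_kernel_const \<alpha> c \<longleftrightarrow> 0 < c \<and> c < 1 \<and>
     (\<forall>t>0. \<forall>x. c * heat_kernel_bound \<alpha> t x \<le> frac_heat_kernel \<alpha> t x \<and>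
                frac_heat_kernel \<alpha> t x \<le> inverse c * heat_kernel_bound \<alpha> t x)"

text \<open>Lebesgue integral with values in \<open>[-\<infinity>, \<infinity>]\<close>. For a modulus of continuity both integrands
  of the dissipation expression are nonpositive by concavity, but the first integral may be
  \<open>-\<infinity>\<close>, for instance at a corner of \<open>w\<close> if \<open>\<alpha> \<ge> 1/2\<close>.\<close>

definition ext_integral :: "real set \<Rightarrow> (real \<Rightarrow> real) \<Rightarrow> ereal" where
  "ext_integral S f = enn2ereal (\<integral>\<^sup>+x\<in>S. ennreal (f x) \<partial>lborel)
                    - enn2ereal (\<integral>\<^sup>+x\<in>S. ennreal (- f x) \<partial>lborel)"

definition dissipation :: "real \<Rightarrow> real \<Rightarrow> (real \<Rightarrow> real) \<Rightarrow> real \<Rightarrow> ereal" where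
  "dissipation c \<alpha> w \<xi> = ereal c *
     (ext_integral {0<..\<xi>/2}
        (\<lambda>\<eta>. (w (\<xi> + 2 * \<eta>) + w (\<xi> - 2 * \<eta>) - 2 * w \<xi>) / \<eta> powr (1 + 2 * \<alpha>))
    + ext_integral {\<xi>/2<..}
        (\<lambda>\<eta>. (w (\<xi> + 2 * \<eta>) - w (2 * \<eta> - \<xi>) - 2 * w \<xi>) / \<eta> powr (1 + 2 * \<alpha>)))"


section \<open>Active scalar equations\<close>

definition Linf_norm :: "('a::euclidean_space \<Rightarrow> real) \<Rightarrow> ereal" where
  "Linf_norm f = esssup lborel (\<lambda>x. ereal \<bar>f x\<bar>)"

text \<open>The operator \<open>U\<close> determines the velocity \<open>u(\<cdot>,t) = U (\<theta>(\<cdot>,t))\<close> from the scalar, and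
  \<open>(u \<cdot> \<nabla>)\<theta>\<close> is the derivative of \<open>\<theta>\<close> in the direction \<open>u\<close>. For \<open>\<alpha> = 0\<close> the dissipative term is
  absent.\<close>

definition active_scalar_solution ::
  "'a::euclidean_space set \<Rightarrow> real \<Rightarrow> (('a \<Rightarrow> real) \<Rightarrow> 'a \<Rightarrow> 'a) \<Rightarrow> ('a \<Rightarrow> real) \<Rightarrow>
   ('a \<Rightarrow> real \<Rightarrow> real) \<Rightarrow> bool" where
  "active_scalar_solution P \<alpha> U \<theta>0 \<theta> \<longleftrightarrow>
     smooth_on (UNIV \<times> {0..}) (\<lambda>(x, t). \<theta> x t) \<and>
     (\<forall>t\<ge>0. periodic P (\<lambda>x. \<theta> x t)) \<and>
     (\<forall>x. \<theta> x 0 = \<theta>0 x) \<and>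
     (\<forall>x. \<forall>t>0.
        ((\<lambda>s. \<theta> x s) has_real_derivative
           frechet_derivative (\<lambda>y. \<theta> y t) (at x) (U (\<lambda>y. \<theta> y t) x)
           - (if \<alpha> = 0 then 0 else frac_laplacian P \<alpha> (\<lambda>y. \<theta> y t) x)) (at t))"

text \<open>\<open>W\<close> is a modulus of continuity of the velocity whenever the scalar has modulus of
  continuity \<open>w\<close>.\<close>

definition velocity_modulus ::
  "'a::euclidean_space set \<Rightarrow> (('a \<Rightarrow> real) \<Rightarrow> 'a \<Rightarrow> 'a) \<Rightarrow> (real \<Rightarrow> real) \<Rightarrow> (real \<Rightarrow> real) \<Rightarrow> bool"
where
  "velocity_modulus P U w W \<longleftrightarrow> modulus_of_continuity W \<and>
     (\<forall>f. smooth_on UNIV f \<and> periodic P f \<and> obeys f w \<longrightarrow> obeys (U f) W)"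

end

theory Submission
  imports Defs
begin

text \<open>The times at which \<open>\<theta>\<close> fails to obey \<open>\<omega>\<close> form a closed set; its least element is the required
  \<open>t1\<close>, and continuity from the left turns the failure into an equality. For closedness, take
  violating pairs at times converging to \<open>T\<close>: by periodicity and monotonicity they may be taken in a
  bounded region. If they do not collapse, the limit pair violates \<open>\<omega>\<close> at time \<open>T\<close>. If they collapse
  to \<open>x\<close> along a direction \<open>e\<close>, concavity forces the slope \<open>\<partial>\<^sub>e\<theta>(x,T)\<close> to be at least
  \<open>\<omega>(\<delta>,T)/\<delta>\<close> for every \<open>\<delta>\<close>, and Taylor expansion of \<open>\<theta>\<close> at \<open>x\<close> then contradicts the
  infinite second derivative of \<open>\<omega>\<close> at 0.\<close>

lemma modulus_ratio_antimono:
  assumes "modulus_of_continuity w" "0 < x" "x \<le> d"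
  shows "w d / d \<le> w x / x"
proof -
  have c: "concave_on {0..} w" and w0: "w 0 = 0"
    using assms by (auto simp: modulus_of_continuity_def)
  have "(1 - x/d) * w 0 + (x/d) * w d \<le> w ((1 - x/d) *\<^sub>R 0 + (x/d) *\<^sub>R d)"
    using c assms by (intro concave_onD[where A="{0..}"]) auto
  then show ?thesis using assms w0 by (auto simp: field_simps)
qed

lemma piecewise_C1_differentiable_near_0:
  assumes "piecewise_C1 w"
  shows "\<forall>\<^sub>F x in at_right 0. w differentiable (at x)"
proof -
  from assms obtain F where F: "finite F" "w C1_differentiable_on ({0<..} - F)"
    by (auto simp: piecewise_C1_def)
  have "open (- (F - {0}))" using F by (intro open_Compl finite_imp_closed) auto
  then have "\<forall>\<^sub>F x in at_right 0. x \<in> - (F - {0})"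
    by (intro eventually_at_in_open' [THEN filter_leD[OF at_le, rotated]]) auto
  moreover have "\<forall>\<^sub>F x in at_right (0::real). x > 0"
    by (simp add: eventually_at_right_less)
  ultimately show ?thesis
  proof eventually_elim
    case (elim x)
    then show ?case using F(2) by (auto simp: C1_differentiable_on_eq)
  qed
qed

lemma second_deriv_0_MInf_no_quadratic_contact:
  assumes mod: "modulus_of_continuity w" and sd: "second_deriv_0_MInf w"
    and up: "\<forall>\<^sub>F h in at_right 0. w h \<le> g * h"
    and lo: "\<forall>\<^sub>F h in at_right 0. g * h - C * h\<^sup>2 \<le> w h"
  shows False
proof -
  have w0: "w 0 = 0" and cont: "continuous_on {0..} w" and pw: "piecewise_C1 w"
    using mod by (auto simp: modulus_of_continuity_def)
  obtain a :: ereal where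
    a: "((\<lambda>h. ereal ((w h - w 0) / h)) \<longlongrightarrow> a) (at_right 0)" and
    q: "((\<lambda>\<xi>. (ereal (deriv w \<xi>) - a) / ereal \<xi>) \<longlongrightarrow> -\<infinity>) (at_right 0)"
    using sd by (auto simp: second_deriv_0_MInf_def)
  have pos: "\<forall>\<^sub>F h in at_right (0::real). h > 0"
    by (simp add: eventually_at_right_less)
  have "((\<lambda>h. (w h - w 0) / h) \<longlongrightarrow> g) (at_right 0)"
  proof (rule tendsto_sandwich)
    show "\<forall>\<^sub>F h in at_right 0. g - C * h \<le> (w h - w 0) / h"
      using lo pos by eventually_elim (auto simp: field_simps w0 power2_eq_square)
    show "\<forall>\<^sub>F h in at_right 0. (w h - w 0) / h \<le> g"
      using up pos by eventually_elim (auto simp: field_simps w0)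
    show "((\<lambda>h. g - C * h) \<longlongrightarrow> g) (at_right 0)"
      by (auto intro!: tendsto_eq_intros)
  qed auto
  then have "((\<lambda>h. ereal ((w h - w 0) / h)) \<longlongrightarrow> ereal g) (at_right 0)"
    by simp
  with a have ag: "a = ereal g"
    using tendsto_unique trivial_limit_at_right_real by blast
  have "\<forall>\<^sub>F \<xi> in at_right 0. (ereal (deriv w \<xi>) - a) / ereal \<xi> < ereal (- 2 * \<bar>C\<bar> - 1)"
    using q by (rule order_tendstoD) auto
  with pos have "\<forall>\<^sub>F \<xi> in at_right 0. deriv w \<xi> - g < (- 2 * \<bar>C\<bar> - 1) * \<xi>"
    by eventually_elim (auto simp: ag field_simps)
  with lo piecewise_C1_differentiable_near_0[OF pw]
  have "\<forall>\<^sub>F \<xi> in at_right 0. g * \<xi> - C * \<xi>\<^sup>2 \<le> w \<xi> \<and> w differentiable (at \<xi>) \<and>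
      deriv w \<xi> - g < (- 2 * \<bar>C\<bar> - 1) * \<xi>"
    by eventually_elim auto
  then obtain b where b: "b > 0" and B: "\<And>\<xi>. 0 < \<xi> \<Longrightarrow> \<xi> < b \<Longrightarrow> g * \<xi> - C * \<xi>\<^sup>2 \<le> w \<xi> \<and>
      w differentiable (at \<xi>) \<and> deriv w \<xi> - g < (- 2 * \<bar>C\<bar> - 1) * \<xi>"
    by (auto simp: eventually_at_right_field)
  define h where "h = b / 2"
  have h: "0 < h" "h < b" using b by (auto simp: h_def)
  define k where "k = (\<lambda>x. w x - g * x + (\<bar>C\<bar> + 1/2) * x\<^sup>2)"
  have "\<exists>l z. 0 < z \<and> z < h \<and> (k has_real_derivative l) (at z) \<and> k h - k 0 = (h - 0) * l"
  proof (rule MVT)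
    show "continuous_on {0..h} k" unfolding k_def
      by (intro continuous_intros continuous_on_subset[OF cont]) auto
    fix x assume x: "0 < x" "x < h"
    then have "(w has_real_derivative deriv w x) (at x)"
      using B[of x] h DERIV_deriv_iff_real_differentiable by auto
    then show "k differentiable (at x)" unfolding k_def
      by (intro derivative_intros) (auto simp: real_differentiable_def)
  qed (use h in auto)
  then obtain l z where z: "0 < z" "z < h" and l: "(k has_real_derivative l) (at z)"
    and e: "k h - k 0 = h * l" by auto
  have "(w has_real_derivative deriv w z) (at z)"
    using B[of z] h z DERIV_deriv_iff_real_differentiable by auto
  then have "(k has_real_derivative (deriv w z - g + (2 * \<bar>C\<bar> + 1) * z)) (at z)"
    unfolding k_def by (auto intro!: derivative_eq_intros simp: algebra_simps)
  with l have "l = deriv w z - g + (2 * \<bar>C\<bar> + 1) * z" by (rule DERIV_unique)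
  also have "\<dots> < 0" using B[of z] z h by (simp add: algebra_simps)
  finally have "h * l < 0" using h by (simp add: mult_pos_neg)
  then have "w h < g * h - (\<bar>C\<bar> + 1/2) * h\<^sup>2" using e by (simp add: k_def w0)
  moreover have "C * h\<^sup>2 \<le> (\<bar>C\<bar> + 1/2) * h\<^sup>2" by (intro mult_right_mono) auto
  moreover have "g * h - C * h\<^sup>2 \<le> w h" using B h by blast
  ultimately show False by linarith
qed

lemma modulus_pos:
  assumes mod: "modulus_of_continuity w" and "second_deriv_0_MInf w" and "x > 0"
  shows "w x > 0"
proof (rule ccontr)
  assume n: "\<not> w x > 0"
  have z: "w h = 0" if "0 < h" "h < x" for h
  proof -
    have "w h \<le> w x" "w h \<ge> 0" using mod that
      by (auto simp: modulus_of_continuity_def mono_on_def)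
    with n show ?thesis by auto
  qed
  have "\<forall>\<^sub>F h in at_right 0. w h = 0"
    using z \<open>x > 0\<close> by (auto simp: eventually_at_right_field)
  then show False
    by (intro second_deriv_0_MInf_no_quadratic_contact[OF assms(1,2), of 0 0])
      (auto elim: eventually_mono)
qed

definition period_lattice :: "'a::real_vector set \<Rightarrow> 'a set" where
  "period_lattice P = {(\<Sum>p\<in>P. of_int (n p) *\<^sub>R p) | n. True}"

lemma periodic_of_int:
  assumes "periodic P f" "p \<in> P"
  shows "f (x + of_int k *\<^sub>R p) = f x"
proof -
  have nat: "f (x + of_nat m *\<^sub>R p) = f x" for m :: nat and x
  proof (induction m)
    case (Suc m)
    have "f (x + of_nat (Suc m) *\<^sub>R p) = f ((x + of_nat m *\<^sub>R p) + p)"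
      by (simp add: algebra_simps)
    with Suc assms show ?case by (simp add: periodic_def)
  qed simp
  show ?thesis
  proof (cases k rule: int_cases2)
    case (nonneg m)
    then show ?thesis using nat[of x m] by simp
  next
    case (nonpos m)
    then show ?thesis using nat[of "x - of_nat m *\<^sub>R p" m] by simp
  qed
qed

lemma periodic_add_lattice:
  assumes "periodic P f" "l \<in> period_lattice P"
  shows "f (x + l) = f x"
proof -
  obtain n where l: "l = (\<Sum>p\<in>P. of_int (n p) *\<^sub>R p)" using assms by (auto simp: period_lattice_def)
  have "f (x + (\<Sum>p\<in>Q. of_int (n p) *\<^sub>R p)) = f x" if "finite Q" "Q \<subseteq> P" for Q
    using that
  proof (induction Q rule: finite_induct)
    case (insert q Q)
    have "f (x + (\<Sum>p\<in>insert q Q. of_int (n p) *\<^sub>R p))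
        = f ((x + (\<Sum>p\<in>Q. of_int (n p) *\<^sub>R p)) + of_int (n q) *\<^sub>R q)"
      using insert by (simp add: algebra_simps)
    with insert show ?case by (simp add: periodic_of_int[OF assms(1)])
  qed simp
  then show ?thesis by (cases "finite P") (auto simp: l)
qed

lemma lattice_cobounded:
  fixes P :: "'a::euclidean_space set"
  assumes "lattice_basis P"
  obtains R where "\<And>x. \<exists>l\<in>period_lattice P. norm (x + l) \<le> R"
proof
  fix x :: 'a
  have fin: "finite P" and sp: "span P = UNIV"
    using assms by (auto simp: lattice_basis_def intro: independent_imp_finite)
  obtain u where x: "x = (\<Sum>p\<in>P. u p *\<^sub>R p)"
    using sp by (auto simp: span_finite[OF fin])
  define l where "l = (\<Sum>p\<in>P. of_int (- \<lfloor>u p\<rfloor>) *\<^sub>R p)"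
  have "x + l = (\<Sum>p\<in>P. frac (u p) *\<^sub>R p)"
    by (simp add: x l_def frac_def sum.distrib[symmetric] algebra_simps sum_negf sum_subtractf)
  also have "norm \<dots> \<le> (\<Sum>p\<in>P. norm p)"
  proof (rule order.trans[OF norm_sum sum_mono])
    fix p
    have "\<bar>frac (u p)\<bar> \<le> 1" by (simp add: frac_lt_1 less_imp_le frac_ge_0)
    then show "norm (frac (u p) *\<^sub>R p) \<le> norm p" by (simp add: mult_left_le_one_le)
  qed
  finally show "\<exists>l\<in>period_lattice P. norm (x + l) \<le> (\<Sum>p\<in>P. norm p)"
    by (intro bexI[of _ l]) (auto simp: period_lattice_def l_def intro: exI[of _ "\<lambda>p. - \<lfloor>u p\<rfloor>"])
qed

lemma periodic_not_obeys_bounded: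
  fixes f :: "'a::euclidean_space \<Rightarrow> real"
  assumes R: "\<And>x. \<exists>l\<in>period_lattice P. norm (x + l) \<le> R"
    and per: "periodic P f" and mod: "modulus_of_continuity w"
    and pos: "\<And>x. x > 0 \<Longrightarrow> w x > 0" and "\<not> obeys f w"
  obtains x y where "x \<noteq> y" "norm x \<le> R" "norm (y - x) \<le> R" "w (norm (x - y)) \<le> f x - f y"
proof -
  obtain x y where "x \<noteq> y" "w (norm (x - y)) \<le> \<bar>f x - f y\<bar>"
    using assms(5) by (force simp: obeys_def)
  then obtain x y where xy: "x \<noteq> y" "w (norm (x - y)) \<le> f x - f y"
    by (metis abs_real_def minus_diff_eq norm_minus_commute)
  obtain l where l: "l \<in> period_lattice P" "norm (x + l) \<le> R" using R by blast
  obtain m where m: "m \<in> period_lattice P" "norm ((y - x) + m) \<le> R" using R by blast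
  have f: "f (x + l) = f x" "f (y + l) = f y" "f ((y + l) + m) = f y"
    using periodic_add_lattice[OF per] l(1) m(1) by auto
  show thesis
  proof (cases "norm (y - x) \<le> R")
    case True
    then show thesis using that[of "x + l" "y + l"] xy l f by auto
  next
    case False
    have d: "norm ((x + l) - (y + l + m)) \<le> norm (x - y)"
      using m(2) False norm_minus_commute[of "y + l + m" "x + l"] norm_minus_commute[of x y]
      by (simp add: algebra_simps)
    have "f x \<noteq> f y" using pos[of "norm (x - y)"] xy by auto
    then have "x + l \<noteq> y + l + m" using f by metis
    moreover have "w (norm ((x + l) - (y + l + m))) \<le> w (norm (x - y))"
      using d mod by (auto simp: modulus_of_continuity_def mono_on_def)
    moreover have "norm ((y + l + m) - (x + l)) \<le> R" using m(2) by (simp add: algebra_simps)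
    ultimately show thesis using that[of "x + l" "y + l + m"] xy(2) l(2) f by auto
  qed
qed

lemma Ck_on_imp_continuous_on: "Ck_on k S f \<Longrightarrow> continuous_on S f"
  by (cases k) (auto intro: has_derivative_continuous_on)

lemma Ck_on_spatial_gradient:
  fixes \<theta> :: "'a::euclidean_space \<Rightarrow> real \<Rightarrow> real"
  assumes "Ck_on 2 (UNIV \<times> {0..}) (\<lambda>(x, t). \<theta> x t)"
  obtains G :: "'a \<Rightarrow> real \<Rightarrow> 'a" where
    "\<And>x t. t \<ge> 0 \<Longrightarrow> ((\<lambda>x. \<theta> x t) has_derivative (\<lambda>v. G x t \<bullet> v)) (at x)"
    "continuous_on (UNIV \<times> {0..}) (\<lambda>(x, t). G x t)"
    "\<And>x t. t \<ge> 0 \<Longrightarrow> (\<lambda>x. G x t) differentiable (at x)"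
proof -
  let ?S = "(UNIV :: 'a set) \<times> {0::real..}"
  have slice: "((\<lambda>x. f (x, t)) has_derivative (\<lambda>v. f' (v, 0))) (at x)"
    if "(f has_derivative f') (at (x, t) within ?S)" "t \<ge> 0"
    for f :: "'a \<times> real \<Rightarrow> real" and f' x t
  proof -
    have "((\<lambda>x. (x, t)) has_derivative (\<lambda>v. (v, 0))) (at x)"
      by (auto intro!: derivative_eq_intros)
    moreover have "(f has_derivative f') (at (x, t) within range (\<lambda>x. (x, t)))"
      using that by (auto intro: has_derivative_subset)
    ultimately show ?thesis
      using diff_chain_within[of "\<lambda>x. (x, t)" "\<lambda>v. (v, 0)" x UNIV f f'] by (simp add: o_def)
  qed
  obtain f' where f': "\<And>z. z \<in> ?S \<Longrightarrow> ((\<lambda>(x, t). \<theta> x t) has_derivative f' z) (at z within ?S)"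
    and C1: "\<And>v. Ck_on (Suc 0) ?S (\<lambda>z. f' z v)"
    using assms by (auto simp: numeral_2_eq_2)
  have D: "\<exists>D. \<forall>z\<in>?S. ((\<lambda>z. f' z v) has_derivative D z) (at z within ?S)" for v
    using C1[of v] by auto
  define G where "G = (\<lambda>x t. \<Sum>b\<in>Basis. f' (x, t) (b, 0) *\<^sub>R b)"
  show thesis
  proof
    fix x :: 'a and t :: real assume t: "t \<ge> 0"
    have d: "((\<lambda>x. \<theta> x t) has_derivative (\<lambda>v. f' (x, t) (v, 0))) (at x)"
      using slice[OF f', of x t] t by simp
    then interpret L: bounded_linear "\<lambda>v. f' (x, t) (v, 0)" by (rule has_derivative_bounded_linear)
    have "f' (x, t) (v, 0) = G x t \<bullet> v" for v
    proof -
      have "f' (x, t) (v, 0) = f' (x, t) (\<Sum>b\<in>Basis. (v \<bullet> b) *\<^sub>R b, 0)"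
        by (simp add: euclidean_representation)
      also have "\<dots> = (\<Sum>b\<in>Basis. (v \<bullet> b) * f' (x, t) (b, 0))"
        by (simp only: L.sum L.scaleR real_scaleR_def)
      also have "\<dots> = G x t \<bullet> v"
        by (simp add: G_def inner_sum_left inner_commute[of v] mult.commute)
      finally show ?thesis .
    qed
    with d show "((\<lambda>x. \<theta> x t) has_derivative (\<lambda>v. G x t \<bullet> v)) (at x)" by simp
    have "(\<lambda>x. f' (x, t) v) differentiable (at x)" for v
      using D[of v] slice[of "\<lambda>z. f' z v" _ x t] t unfolding differentiable_def by fastforce
    then show "(\<lambda>x. G x t) differentiable (at x)"
      unfolding G_def by (intro differentiable_sum) (auto intro!: differentiable_scaleR)
  next
    have "continuous_on ?S (\<lambda>z. f' z v)" for v
      using D[of v] has_derivative_continuous_on by metis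
    then show "continuous_on ?S (\<lambda>(x, t). G x t)"
      unfolding G_def case_prod_beta by (auto intro!: continuous_intros)
  qed
qed

lemma inner_gradient_mvt:
  fixes f :: "'a::euclidean_space \<Rightarrow> real"
  assumes "\<And>x. (f has_derivative (\<lambda>v. G x \<bullet> v)) (at x)"
  obtains s where "0 < s" "s < 1" "f y - f x = G (x + s *\<^sub>R (y - x)) \<bullet> (y - x)"
proof -
  have d: "((\<lambda>s. f (x + s *\<^sub>R (y - x))) has_real_derivative G (x + s *\<^sub>R (y - x)) \<bullet> (y - x)) (at s)"
    for s
  proof -
    have "((\<lambda>s. f (x + s *\<^sub>R (y - x))) has_derivative
        (\<lambda>h. G (x + s *\<^sub>R (y - x)) \<bullet> (h *\<^sub>R (y - x)))) (at s)"
      by (rule has_derivative_compose[OF _ assms]) (auto intro!: derivative_eq_intros)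
    then show ?thesis by (simp add: has_field_derivative_def mult.commute[of _ "_ \<bullet> _"])
  qed
  from MVT2[of 0 1, OF _ d] show thesis using that by auto
qed

lemma gradient_quadratic_lower_bound:
  fixes f :: "'a::euclidean_space \<Rightarrow> real"
  assumes G: "\<And>x. (f has_derivative (\<lambda>v. G x \<bullet> v)) (at x)"
    and d: "G differentiable (at x)" and e: "norm e = 1"
  obtains C where "\<forall>\<^sub>F h in at_right 0. (G x \<bullet> e) * h - C * h\<^sup>2 \<le> f (x + h *\<^sub>R e) - f x"
proof -
  obtain D where D: "(G has_derivative D) (at x)" using d by (auto simp: differentiable_def)
  then interpret D: bounded_linear D by (rule has_derivative_bounded_linear)
  obtain K where K: "K > 0" "\<And>v. norm (D v) \<le> norm v * K" using D.pos_bounded by blast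
  obtain r where r: "r > 0"
    "\<And>y. norm (y - x) < r \<Longrightarrow> norm (G y - G x - D (y - x)) \<le> 1 * norm (y - x)"
    using D unfolding has_derivative_at_alt by (metis zero_less_one)
  have lip: "norm (G y - G x) \<le> (K + 1) * norm (y - x)" if "norm (y - x) < r" for y
    using norm_triangle_sub[of "G y - G x" "D (y - x)"] r(2)[OF that] K(2)[of "y - x"]
    by (simp add: algebra_simps)
  have "(G x \<bullet> e) * h - (K + 1) * h\<^sup>2 \<le> f (x + h *\<^sub>R e) - f x" if h: "0 < h" "h < r" for h
  proof -
    obtain s where s: "0 < s" "s < 1"
      "f (x + h *\<^sub>R e) - f x = G (x + s *\<^sub>R (x + h *\<^sub>R e - x)) \<bullet> (x + h *\<^sub>R e - x)"
      using inner_gradient_mvt[where f=f and G=G, OF G] by blast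
    define y where "y = x + (s * h) *\<^sub>R e"
    have n: "norm (y - x) = s * h" and sh: "s * h < h" using s h e by (auto simp: y_def)
    have f: "f (x + h *\<^sub>R e) - f x = h * (G y \<bullet> e)" using s by (simp add: y_def)
    have "\<bar>(G y - G x) \<bullet> e\<bar> \<le> norm (G y - G x) * norm e" by (rule Cauchy_Schwarz_ineq2)
    also have "\<dots> \<le> (K + 1) * (s * h)" using lip[of y] n sh h e by simp
    also have "\<dots> \<le> (K + 1) * h" using sh K by (intro mult_left_mono) auto
    finally have "G x \<bullet> e - (K + 1) * h \<le> G y \<bullet> e" by (simp add: inner_diff_left)
    then have "h * (G x \<bullet> e - (K + 1) * h) \<le> h * (G y \<bullet> e)" using h by (intro mult_left_mono) auto
    then show ?thesis unfolding f by (simp add: algebra_simps power2_eq_square)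
  qed
  then show thesis using that[of "K + 1"] r(1) by (auto simp: eventually_at_right_field)
qed

lemma collapsing_pairs_slope:
  fixes \<theta> :: "'a::euclidean_space \<Rightarrow> real \<Rightarrow> real"
  assumes G: "\<And>x t. t \<ge> 0 \<Longrightarrow> ((\<lambda>x. \<theta> x t) has_derivative (\<lambda>v. G x t \<bullet> v)) (at x)"
    and Gc: "continuous_on (UNIV \<times> {0..}) (\<lambda>(x, t). G x t)"
    and w: "continuous_on ({0..} \<times> {0..}) (\<lambda>(\<xi>, t). \<omega> \<xi> t)"
    and mod: "\<And>t. t \<ge> 0 \<Longrightarrow> modulus_of_continuity (\<lambda>\<xi>. \<omega> \<xi> t)"
    and T: "\<And>n. T n \<ge> 0" "T \<longlonglongrightarrow> t"
    and lim: "X \<longlonglongrightarrow> x" "Y \<longlonglongrightarrow> x" "(\<lambda>n. sgn (X n - Y n)) \<longlonglongrightarrow> e"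
    and ne: "\<And>n. X n \<noteq> Y n"
    and bad: "\<And>n. \<omega> (norm (X n - Y n)) (T n) \<le> \<theta> (X n) (T n) - \<theta> (Y n) (T n)"
    and \<delta>: "\<delta> > 0"
  shows "\<omega> \<delta> t \<le> (G x t \<bullet> e) * \<delta>"
proof -
  have t: "t \<ge> 0" using T LIMSEQ_le_const by blast
  have "\<exists>s. 0 < s \<and> s < 1 \<and> \<theta> (X n) (T n) - \<theta> (Y n) (T n)
      = G (Y n + s *\<^sub>R (X n - Y n)) (T n) \<bullet> (X n - Y n)" for n
    using inner_gradient_mvt[where f="\<lambda>x. \<theta> x (T n)" and G="\<lambda>x. G x (T n)", OF G[OF T(1)]]
    by metis
  then obtain s where s: "\<And>n. 0 < s n \<and> s n < 1 \<and> \<theta> (X n) (T n) - \<theta> (Y n) (T n)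
      = G (Y n + s n *\<^sub>R (X n - Y n)) (T n) \<bullet> (X n - Y n)" by metis
  define Z where "Z = (\<lambda>n. Y n + s n *\<^sub>R (X n - Y n))"
  have XY: "(\<lambda>n. X n - Y n) \<longlonglongrightarrow> 0" using tendsto_diff[OF lim(1,2)] by simp
  have "(\<lambda>n. s n *\<^sub>R (X n - Y n)) \<longlonglongrightarrow> 0"
  proof (rule Lim_null_comparison[OF _ tendsto_norm_zero[OF XY]])
    show "\<forall>\<^sub>F n in sequentially. norm (s n *\<^sub>R (X n - Y n)) \<le> norm (X n - Y n)"
      using s by (intro always_eventually allI) (simp add: mult_left_le_one_le less_imp_le)
  qed
  then have Z: "Z \<longlonglongrightarrow> x" unfolding Z_def using tendsto_add[OF lim(2)] by fastforce
  have "(\<lambda>n. (case (Z n, T n) of (x, t) \<Rightarrow> G x t)) \<longlonglongrightarrow> (case (x, t) of (x, t) \<Rightarrow> G x t)"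
    by (rule continuous_on_tendsto_compose[OF Gc tendsto_Pair[OF Z T(2)]]) (use t T in auto)
  then have slope: "(\<lambda>n. G (Z n) (T n) \<bullet> sgn (X n - Y n)) \<longlonglongrightarrow> G x t \<bullet> e"
    by (auto intro: tendsto_inner lim)
  have wc: "(\<lambda>n. \<omega> \<delta> (T n) / \<delta>) \<longlonglongrightarrow> \<omega> \<delta> t / \<delta>"
  proof -
    have "(\<lambda>n. (case (\<delta>, T n) of (x, t) \<Rightarrow> \<omega> x t)) \<longlonglongrightarrow> (case (\<delta>, t) of (x, t) \<Rightarrow> \<omega> x t)"
      by (rule continuous_on_tendsto_compose[OF w tendsto_Pair[OF tendsto_const T(2)]])
        (use t T \<delta> in auto)
    then show ?thesis using \<delta> by (auto intro: tendsto_divide)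
  qed
  have "\<forall>\<^sub>F n in sequentially. norm (X n - Y n) < \<delta>"
    using tendsto_norm_zero[OF XY] \<delta> by (rule order_tendstoD)
  then have "\<forall>\<^sub>F n in sequentially. \<omega> \<delta> (T n) / \<delta> \<le> G (Z n) (T n) \<bullet> sgn (X n - Y n)"
  proof eventually_elim
    case (elim n)
    let ?d = "norm (X n - Y n)"
    have d: "?d > 0" using ne[of n] by simp
    have "\<omega> \<delta> (T n) / \<delta> \<le> \<omega> ?d (T n) / ?d"
      using modulus_ratio_antimono[OF mod[OF T(1)] d, of \<delta>] elim by simp
    also have "\<dots> \<le> (\<theta> (X n) (T n) - \<theta> (Y n) (T n)) / ?d"
      using bad[of n] d by (simp add: divide_right_mono)
    also have "\<dots> = G (Z n) (T n) \<bullet> sgn (X n - Y n)"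
      using s[of n] by (simp add: Z_def sgn_div_norm divide_inverse mult.commute)
    finally show ?case .
  qed
  with wc slope have "\<omega> \<delta> t / \<delta> \<le> G x t \<bullet> e"
    using tendsto_le trivial_limit_sequentially by blast
  then show ?thesis using \<delta> by (simp add: field_simps)
qed

lemma closed_not_obeys_times:
  fixes \<theta> :: "'a::euclidean_space \<Rightarrow> real \<Rightarrow> real"
  assumes P: "lattice_basis P"
    and smooth: "Ck_on 2 (UNIV \<times> {0..}) (\<lambda>(x, t). \<theta> x t)"
    and per: "\<And>t. t \<ge> 0 \<Longrightarrow> periodic P (\<lambda>x. \<theta> x t)"
    and w: "continuous_on ({0..} \<times> {0..}) (\<lambda>(\<xi>, t). \<omega> \<xi> t)"
    and mod: "\<And>t. t \<ge> 0 \<Longrightarrow> modulus_of_continuity (\<lambda>\<xi>. \<omega> \<xi> t)"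
    and sd: "\<And>t. t \<ge> 0 \<Longrightarrow> second_deriv_0_MInf (\<lambda>\<xi>. \<omega> \<xi> t)"
  shows "closed {t. t \<ge> 0 \<and> \<not> obeys (\<lambda>x. \<theta> x t) (\<lambda>\<xi>. \<omega> \<xi> t)}"
  unfolding closed_sequential_limits
proof safe
  fix S :: "nat \<Rightarrow> real" and t
  assume S: "\<forall>n. S n \<in> {t. t \<ge> 0 \<and> \<not> obeys (\<lambda>x. \<theta> x t) (\<lambda>\<xi>. \<omega> \<xi> t)}" and St: "S \<longlonglongrightarrow> t"
  show t: "0 \<le> t" using S LIMSEQ_le_const[OF St] by auto
  assume ob: "obeys (\<lambda>x. \<theta> x t) (\<lambda>\<xi>. \<omega> \<xi> t)"
  obtain G where G: "\<And>x t. t \<ge> 0 \<Longrightarrow> ((\<lambda>x. \<theta> x t) has_derivative (\<lambda>v. G x t \<bullet> v)) (at x)"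
    and Gc: "continuous_on (UNIV \<times> {0..}) (\<lambda>(x, t). G x t)"
    and Gd: "\<And>x t. t \<ge> 0 \<Longrightarrow> (\<lambda>x. G x t) differentiable (at x)"
    using Ck_on_spatial_gradient[OF smooth] by blast
  have \<theta>c: "continuous_on (UNIV \<times> {0..}) (\<lambda>(x, t). \<theta> x t)"
    using smooth by (rule Ck_on_imp_continuous_on)
  obtain R where R: "\<And>x. \<exists>l\<in>period_lattice P. norm (x + l) \<le> R" using lattice_cobounded[OF P] by blast
  have "\<exists>x y. x \<noteq> y \<and> norm x \<le> R \<and> norm (y - x) \<le> R \<and>
      \<omega> (norm (x - y)) (S n) \<le> \<theta> x (S n) - \<theta> y (S n)" for n
  proof -
    have n: "S n \<ge> 0" "\<not> obeys (\<lambda>x. \<theta> x (S n)) (\<lambda>\<xi>. \<omega> \<xi> (S n))" using S by auto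
    show ?thesis
      by (rule periodic_not_obeys_bounded[OF R per[OF n(1)] mod[OF n(1)]
            modulus_pos[OF mod[OF n(1)] sd[OF n(1)]] n(2)]) blast+
  qed
  then obtain X Y where XY: "\<And>n. X n \<noteq> Y n" "\<And>n. norm (X n) \<le> R" "\<And>n. norm (Y n - X n) \<le> R"
    "\<And>n. \<omega> (norm (X n - Y n)) (S n) \<le> \<theta> (X n) (S n) - \<theta> (Y n) (S n)" by metis
  have "norm (Y n) \<le> 2 * R" for n using norm_triangle_sub[of "Y n" "X n"] XY(2,3)[of n] by simp
  then have "\<forall>n. (X n, Y n, sgn (X n - Y n)) \<in> cball 0 R \<times> cball 0 (2 * R) \<times> sphere 0 1"
    using XY by (auto simp: norm_sgn)
  moreover have "compact (cball (0::'a) R \<times> cball (0::'a) (2 * R) \<times> sphere (0::'a) 1)"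
    by (intro compact_Times compact_cball compact_sphere)
  ultimately obtain l r where r: "strict_mono r" and lr: "((\<lambda>n. (X n, Y n, sgn (X n - Y n))) \<circ> r) \<longlonglongrightarrow> l"
    and l: "l \<in> cball 0 R \<times> cball 0 (2 * R) \<times> sphere 0 1"
    unfolding compact_def by meson
  obtain x y e where lxy: "l = (x, y, e)" by (cases l) auto
  have e: "norm e = 1" using l lxy by simp
  have lx: "(\<lambda>n. X (r n)) \<longlonglongrightarrow> x" using tendsto_fst[OF lr] by (simp add: lxy o_def)
  have ly: "(\<lambda>n. Y (r n)) \<longlonglongrightarrow> y" using tendsto_fst[OF tendsto_snd[OF lr]] by (simp add: lxy o_def)
  have le: "(\<lambda>n. sgn (X (r n) - Y (r n))) \<longlonglongrightarrow> e"
    using tendsto_snd[OF tendsto_snd[OF lr]] by (simp add: lxy o_def)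
  have lS: "(\<lambda>n. S (r n)) \<longlonglongrightarrow> t" using LIMSEQ_subseq_LIMSEQ[OF St r] by (simp add: o_def)
  have S0: "S n \<ge> 0" for n using S by auto
  show False
  proof (cases "x = y")
    case False
    have \<theta>lim: "(\<lambda>n. \<theta> (V n) (S (r n))) \<longlonglongrightarrow> \<theta> v t" if "V \<longlonglongrightarrow> v" for V v
      using continuous_on_tendsto_compose[OF \<theta>c tendsto_Pair[OF that lS]] S0 t by simp
    have "(\<lambda>n. norm (X (r n) - Y (r n))) \<longlonglongrightarrow> norm (x - y)" by (intro tendsto_intros lx ly)
    then have "(\<lambda>n. \<omega> (norm (X (r n) - Y (r n))) (S (r n))) \<longlonglongrightarrow> \<omega> (norm (x - y)) t"
      using continuous_on_tendsto_compose[OF w tendsto_Pair[OF _ lS], of _ "norm (x - y)"] S0 t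
      by simp
    then have "\<omega> (norm (x - y)) t \<le> \<theta> x t - \<theta> y t"
      by (rule LIMSEQ_le[OF _ tendsto_diff[OF \<theta>lim[OF lx] \<theta>lim[OF ly]]]) (use XY(4) in auto)
    moreover have "\<bar>\<theta> x t - \<theta> y t\<bar> < \<omega> (norm (x - y)) t"
      using ob False by (auto simp: obeys_def)
    ultimately show False by linarith
  next
    case True
    have up: "\<omega> \<delta> t \<le> (G x t \<bullet> e) * \<delta>" if "\<delta> > 0" for \<delta>
      by (rule collapsing_pairs_slope[where X="\<lambda>n. X (r n)" and Y="\<lambda>n. Y (r n)" and T="\<lambda>n. S (r n)",
            OF G Gc w mod S0 lS lx ly[folded True] le XY(1) XY(4) that])
    obtain C where C: "\<forall>\<^sub>F h in at_right 0. (G x t \<bullet> e) * h - C * h\<^sup>2 \<le> \<theta> (x + h *\<^sub>R e) t - \<theta> x t"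
      using gradient_quadratic_lower_bound[OF G[OF t] Gd[OF t] e] by blast
    have pos: "\<forall>\<^sub>F h in at_right (0::real). h > 0" by (simp add: eventually_at_right_less)
    have "\<forall>\<^sub>F h in at_right 0. (G x t \<bullet> e) * h - C * h\<^sup>2 \<le> \<omega> h t"
      using C pos
    proof eventually_elim
      case (elim h)
      have "\<bar>\<theta> (x + h *\<^sub>R e) t - \<theta> x t\<bar> < \<omega> (norm (x + h *\<^sub>R e - x)) t"
        using ob elim e unfolding obeys_def real_norm_def[symmetric]
        by (metis add_cancel_right_right less_irrefl norm_zero scaleR_eq_0_iff zero_neq_one)
      then show ?case using elim e by simp
    qed
    moreover have "\<forall>\<^sub>F h in at_right 0. \<omega> h t \<le> (G x t \<bullet> e) * h"
      using pos by eventually_elim (rule up)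
    ultimately show False
      using second_deriv_0_MInf_no_quadratic_contact[OF mod[OF t] sd[OF t]] by blast
  qed
qed

theorem lemma2p3:
  fixes P :: "(real ^ 'd) set"
    and \<alpha> c :: real
    and U :: "(real ^ 'd \<Rightarrow> real) \<Rightarrow> real ^ 'd \<Rightarrow> real ^ 'd"
    and \<theta>0 :: "real ^ 'd \<Rightarrow> real"
    and \<theta> :: "real ^ 'd \<Rightarrow> real \<Rightarrow> real"
    and \<omega> :: "real \<Rightarrow> real \<Rightarrow> real"
    and \<Omega> :: "(real \<Rightarrow> real) \<Rightarrow> real \<Rightarrow> real"
  assumes "lattice_basis P"
    and "0 \<le> \<alpha>" "\<alpha> < 1"
    and "\<alpha> > 0 \<Longrightarrow> heat_kernel_const \<alpha> c"
    and "active_scalar_solution P \<alpha> U \<theta>0 \<theta>"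
    and "continuous_on ({0..} \<times> {0..}) (\<lambda>(\<xi>, t). \<omega> \<xi> t)"
    and "\<And>\<xi>. \<xi> \<ge> 0 \<Longrightarrow> piecewise_C1 (\<lambda>t. \<omega> \<xi> t)"
    and "\<And>t. t \<ge> 0 \<Longrightarrow> modulus_of_continuity (\<lambda>\<xi>. \<omega> \<xi> t)"
    and "\<And>t. t \<ge> 0 \<Longrightarrow> second_deriv_0_MInf (\<lambda>\<xi>. \<omega> \<xi> t)"
    and "obeys \<theta>0 (\<lambda>\<xi>. \<omega> \<xi> 0)"
    and "\<And>t. t > 0 \<Longrightarrow> velocity_modulus P U (\<lambda>\<xi>. \<omega> \<xi> t) (\<Omega> (\<lambda>\<xi>. \<omega> \<xi> t))"
    and "\<And>\<xi> t. \<xi> > 0 \<Longrightarrow> t > 0 \<Longrightarrow> ereal (\<omega> \<xi> t) \<le> 2 * Linf_norm (\<lambda>x. \<theta> x t) \<Longrightarrow>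
           ereal (lower_deriv (\<lambda>s. \<omega> \<xi> s) t)
             > ereal (\<Omega> (\<lambda>\<zeta>. \<omega> \<zeta> t) \<xi> * upper_deriv (\<lambda>\<zeta>. \<omega> \<zeta> t) \<xi>)
               + (if \<alpha> = 0 then 0 else dissipation c \<alpha> (\<lambda>\<zeta>. \<omega> \<zeta> t) \<xi>)"
    and "\<exists>t>0. \<not> obeys (\<lambda>x. \<theta> x t) (\<lambda>\<xi>. \<omega> \<xi> t)"
  shows "\<exists>t1>0. \<exists>x y. x \<noteq> y \<and>
           (\<forall>t. 0 \<le> t \<and> t < t1 \<longrightarrow> obeys (\<lambda>x. \<theta> x t) (\<lambda>\<xi>. \<omega> \<xi> t)) \<and>
           \<theta> x t1 - \<theta> y t1 = \<omega> (norm (x - y)) t1"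
proof -
  let ?ob = "\<lambda>t. obeys (\<lambda>x. \<theta> x t) (\<lambda>\<xi>. \<omega> \<xi> t)"
  define B where "B = {t. t \<ge> 0 \<and> \<not> ?ob t}"
  have C2: "Ck_on 2 (UNIV \<times> {0..}) (\<lambda>(x, t). \<theta> x t)"
    and per: "\<And>t. t \<ge> 0 \<Longrightarrow> periodic P (\<lambda>x. \<theta> x t)" and init: "(\<lambda>x. \<theta> x 0) = \<theta>0"
    using assms(5) unfolding active_scalar_solution_def smooth_on_def by auto
  have "closed B" unfolding B_def
    using closed_not_obeys_times[OF assms(1) C2 per assms(6) assms(8) assms(9)] by blast
  moreover have "B \<noteq> {}" "bdd_below B" using assms(13) less_imp_le by (auto simp: B_def)
  ultimately have "Inf B \<in> B" by (intro closed_contains_Inf)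
  define t1 where "t1 = Inf B"
  have t1: "t1 \<in> B" using \<open>Inf B \<in> B\<close> by (simp add: t1_def)
  have before: "?ob t" if "0 \<le> t" "t < t1" for t
    using that cInf_lower[OF _ \<open>bdd_below B\<close>, of t] by (force simp: B_def t1_def)
  have "t1 \<noteq> 0" using t1 assms(10) init by (auto simp: B_def)
  then have pos: "t1 > 0" using t1 by (simp add: B_def)
  obtain x y where xy: "x \<noteq> y" "\<omega> (norm (x - y)) t1 \<le> \<bar>\<theta> x t1 - \<theta> y t1\<bar>"
    using t1 by (force simp: B_def obeys_def)
  have \<theta>c: "continuous_on {0..} (\<theta> v)" for v
    using continuous_on_compose2[OF Ck_on_imp_continuous_on[OF C2]
        continuous_on_Pair[OF continuous_on_const[of "{0..}" v] continuous_on_id]]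
    by (simp add: image_subset_iff)
  have wc: "continuous_on {0..} (\<omega> (norm (x - y)))"
    using continuous_on_compose2[OF assms(6)
        continuous_on_Pair[OF continuous_on_const[of "{0..}" "norm (x - y)"] continuous_on_id]]
    by (simp add: image_subset_iff)
  have "\<bar>\<theta> x t1 - \<theta> y t1\<bar> - \<omega> (norm (x - y)) t1 \<le> 0"
  proof (rule continuous_le_on_closure[where S="{0..<t1}" and x=t1
        and f="\<lambda>t. \<bar>\<theta> x t - \<theta> y t\<bar> - \<omega> (norm (x - y)) t"])
    show "continuous_on (closure {0..<t1}) (\<lambda>t. \<bar>\<theta> x t - \<theta> y t\<bar> - \<omega> (norm (x - y)) t)"
      using pos by (intro continuous_intros continuous_on_subset[OF \<theta>c] continuous_on_subset[OF wc]) auto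
    show "\<bar>\<theta> x t - \<theta> y t\<bar> - \<omega> (norm (x - y)) t \<le> 0" if "t \<in> {0..<t1}" for t
      using before[of t] that xy(1) by (auto simp: obeys_def less_imp_le)
  qed (use pos in auto)
  with xy have eq: "\<bar>\<theta> x t1 - \<theta> y t1\<bar> = \<omega> (norm (x - y)) t1" by simp
  show ?thesis
  proof (cases "\<theta> x t1 \<ge> \<theta> y t1")
    case True
    then show ?thesis using pos before xy(1) eq by (intro exI[of _ t1]) auto
  next
    case False
    then have "\<theta> y t1 - \<theta> x t1 = \<omega> (norm (y - x)) t1" using eq by (simp add: norm_minus_commute)
    then show ?thesis using pos before xy(1) by metis
  qed
qed

end
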